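(* Let $q$ be a prime power, $R=\mathbb{F}_q+u\mathbb{F}_q=\mathbb{F}_q[u]/(u^2)$, and let $\mathcal{C}$ be a linear code of length $n$ over $R$ with generator matrix $G$. Write $GG^T=A_0+uA_1$ with matrices $A_0,A_1$ over $\mathbb{F}_q$. Let $r=\operatorname{rank}_{\mathbb{F}_q}(A_0)$ and let $k$ be the number of rows of $G$. Then $$n_\ell(\mathcal{C})=n+k-r.$$
   Context: A linear code $\mathcal{C}$ of length $n$ over $R$ is an $R$-submodule of $R^n$. A generator matrix $G$ of $\mathcal{C}$ is a matrix whose rows $\mathbf{c}_1,\dots,\mathbf{c}_{k_1}\in R^n\setminus(uR)^n$ and $\mathbf{c}_{k_1+1},\dots,\mathbf{c}_{k_1+k_2}\in(uR)^n$ are codewords such that every codeword has a unique representation $\sum_{i=1}^{k_1}a_i\mathbf{c}_i+\sum_{j=k_1+1}^{k_1+k_2}b_j\mathbf{c}_j$ with $a_i\in R$, $b_j\in\mathbb{F}_q$. The dual of a code $\mathcal{D}\subseteq R^N$ is $\mathcal{D}^\perp=\{\mathbf{x}\in R^N : \mathbf{x}\cdot\mathbf{c}=0\text{ for all }\mathbf{c}\in\mathcal{D}\}$ (standard dot product), and $\mathcal{D}$ is LCD if $\mathcal{D}\cap\mathcal{D}^\perp=\{0\}$. An LCD embedding of $\mathcal{C}$ is an LCD code over $R$ generated by the rows of $[G\mid D]$ for some matrix $D$ over $R$ (possibly with zero columns). $n_\ell(\mathcal{C})$ denotes the smallest length of an LCD embedding of $\mathcal{C}$. Known fact (Bhowmick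 et al.): every LCD code over $R$ is free, and a free code with generator matrix $G$ is LCD if and only if $GG^T$ is invertible. *)

theory Defs
  imports "Jordan_Normal_Form.DL_Rank"
begin

section \<open>The ring $R = F_q + u F_q$\<close>

text \<open>A finite field is a type of class \<^class>\<open>field\<close> and \<^class>\<open>finite\<close>.
  \<open>DN a b\<close> stands for $a + u b$ with $u^2 = 0$.\<close>

datatype 'a dual_number = DN (part0: 'a) (part1: 'a)

instantiation dual_number :: (field) comm_ring_1
begin
definition "0 = DN 0 0"
definition "1 = DN 1 0"
definition "x + y = DN (part0 x + part0 y) (part1 x + part1 y)"
definition "x - y = DN (part0 x - part0 y) (part1 x - part1 y)"
definition "- x = DN (- part0 x) (- part1 x)"
definition "x * y = DN (part0 x * part0 y) (part0 x * part1 y + part1 x * part0 y)"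
instance
  by standard
    (auto simp: zero_dual_number_def one_dual_number_def plus_dual_number_def
      minus_dual_number_def uminus_dual_number_def times_dual_number_def algebra_simps)
end

definition base :: "'a::field \<Rightarrow> 'a dual_number" where
  "base a = DN a 0"

definition u :: "'a::field dual_number" where
  "u = DN 0 1"

lemma part_simps [simp]:
  "part0 0 = 0" "part1 0 = 0" "part0 1 = 1" "part1 1 = 0"
  "part0 (x + y) = part0 x + part0 y" "part1 (x + y) = part1 x + part1 y"
  "part0 (x - y) = part0 x - part0 y" "part1 (x - y) = part1 x - part1 y"
  "part0 (- x) = - part0 x" "part1 (- x) = - part1 x"
  "part0 (x * y) = part0 x * part0 y"
  "part1 (x * y) = part0 x * part1 y + part1 x * part0 y"
  "part0 (base a) = a" "part1 (base a) = 0" "part0 u = 0" "part1 u = 1"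
  by (simp_all add: zero_dual_number_def one_dual_number_def plus_dual_number_def
      minus_dual_number_def uminus_dual_number_def times_dual_number_def base_def u_def)

lemma dual_number_eq_iff: "x = y \<longleftrightarrow> part0 x = part0 y \<and> part1 x = part1 y"
  by (cases x; cases y) simp

lemma dual_number_decomp: "x = base (part0 x) + u * base (part1 x)"
  by (simp add: dual_number_eq_iff)

text \<open>Evaluation at \<^const>\<open>u\<close> is a surjective ring homomorphism from the polynomial
  ring whose kernel is the ideal generated by $X^2$, so \<^typ>\<open>'a dual_number\<close> is
  $F_q[u]/(u^2)$.\<close>

definition eval_u :: "'a::field poly \<Rightarrow> 'a dual_number" where
  "eval_u p = poly (map_poly base p) u"

lemma eval_u_coeff: "eval_u p = DN (coeff p 0) (coeff p 1)"
proof (induction p)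
  case 0
  show ?case by (simp add: eval_u_def zero_dual_number_def)
next
  case (pCons a p)
  have "base (0::'a) = 0" by (simp add: dual_number_eq_iff)
  then have "eval_u (pCons a p) = base a + u * eval_u p"
    by (auto simp: eval_u_def map_poly_pCons)
  then show ?case by (simp add: pCons.IH dual_number_eq_iff)
qed

lemma eval_u_hom:
  "eval_u 0 = 0" "eval_u 1 = 1"
  "eval_u (p + q) = eval_u p + eval_u q" "eval_u (p * q) = eval_u p * eval_u q"
  by (simp_all add: eval_u_coeff dual_number_eq_iff coeff_mult)

lemma surj_eval_u: "surj eval_u"
proof (rule surjI)
  show "eval_u [:part0 x, part1 x:] = x" for x :: "'a dual_number"
    by (simp add: eval_u_coeff)
qed

lemma eval_u_eq_0_iff: "eval_u p = 0 \<longleftrightarrow> monom 1 2 dvd p"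
  by (auto simp: eval_u_coeff dual_number_eq_iff monom_1_dvd_iff' less_2_cases_iff)


section \<open>Codes over $R$\<close>

definition linear_code :: "nat \<Rightarrow> 'a::field dual_number vec set \<Rightarrow> bool" where
  "linear_code n C \<longleftrightarrow> submodule class_ring C (module_vec TYPE('a dual_number) n)"

definition dual_code :: "nat \<Rightarrow> 'a::field dual_number vec set \<Rightarrow> 'a dual_number vec set" where
  "dual_code n C = {x \<in> carrier_vec n. \<forall>c\<in>C. x \<bullet> c = 0}"

definition lcd_code :: "nat \<Rightarrow> 'a::field dual_number vec set \<Rightarrow> bool" where
  "lcd_code n C \<longleftrightarrow> linear_code n C \<and> C \<inter> dual_code n C = {0\<^sub>v n}"

definition row_span :: "'a::field dual_number mat \<Rightarrow> 'a dual_number vec set" where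
  "row_span A = LinearCombinations.module.span class_ring
     (module_vec TYPE('a dual_number) (dim_col A)) (set (rows A))"

definition uvecs :: "nat \<Rightarrow> 'a::field dual_number vec set" where
  "uvecs n = {v \<in> carrier_vec n. \<forall>i<n. v $ i \<in> range ((*) u)}"

definition generator_sum ::
  "nat \<Rightarrow> nat \<Rightarrow> 'a::field dual_number mat \<Rightarrow> 'a dual_number vec \<Rightarrow> 'a vec
    \<Rightarrow> 'a dual_number vec" where
  "generator_sum k1 k2 G a b =
     finsum_vec TYPE('a dual_number) (dim_col G) (\<lambda>i. a $ i \<cdot>\<^sub>v row G i) {..<k1} +
     finsum_vec TYPE('a dual_number) (dim_col G)
       (\<lambda>j. base (b $ j) \<cdot>\<^sub>v row G (k1 + j)) {..<k2}"

definition generator_matrix ::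
  "nat \<Rightarrow> 'a::field dual_number vec set \<Rightarrow> 'a dual_number mat \<Rightarrow> bool" where
  "generator_matrix n C G \<longleftrightarrow>
     dim_col G = n \<and> set (rows G) \<subseteq> C \<and>
     (\<exists>k1 k2. dim_row G = k1 + k2 \<and>
        (\<forall>i<k1. row G i \<notin> uvecs n) \<and>
        (\<forall>j<k2. row G (k1 + j) \<in> uvecs n) \<and>
        (\<forall>c\<in>C. \<exists>!p. p \<in> carrier_vec k1 \<times> carrier_vec k2 \<and>
           c = generator_sum k1 k2 G (fst p) (snd p)))"

text \<open>The block matrix $[A \mid B]$.\<close>

definition append_cols :: "'a::zero mat \<Rightarrow> 'a mat \<Rightarrow> 'a mat" where
  "append_cols A B = four_block_mat A B (0\<^sub>m 0 (dim_col A)) (0\<^sub>m 0 (dim_col B))"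

text \<open>The notion is one of the code \<open>C\<close>, so the generator matrix is existentially
  quantified; \<open>lcd_embedding_iff\<close> below shows that every generator matrix
  of \<open>C\<close> yields the same embeddings.\<close>

definition lcd_embedding ::
  "nat \<Rightarrow> 'a::field dual_number vec set \<Rightarrow> nat \<Rightarrow> 'a dual_number vec set \<Rightarrow> bool" where
  "lcd_embedding n C N E \<longleftrightarrow> lcd_code N E \<and>
     (\<exists>G m D. generator_matrix n C G \<and> D \<in> carrier_mat (dim_row G) m \<and>
        N = n + m \<and> E = row_span (append_cols G D))"

lemma generator_sum_eq:
  fixes G :: "'a::field dual_number mat"
  assumes G: "dim_row G = k1 + k2" and a: "a \<in> carrier_vec k1" and b: "b \<in> carrier_vec k2"
  shows "generator_sum k1 k2 G a b = transpose_mat G *\<^sub>v (a @\<^sub>v map_vec base b)"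
proof (rule eq_vecI)
  let ?n = "dim_col G" and ?c = "a @\<^sub>v map_vec base b"
  have "finsum_vec TYPE('a dual_number) ?n (\<lambda>j. base (b $ j) \<cdot>\<^sub>v row G (k1 + j)) {..<k2}
      \<in> carrier_vec ?n"
    by (rule finsum_vec_closed) auto
  then have dim: "dim_vec (generator_sum k1 k2 G a b) = ?n"
    and ix: "\<And>l. l < ?n \<Longrightarrow> generator_sum k1 k2 G a b $ l =
      finsum_vec TYPE('a dual_number) ?n (\<lambda>i. a $ i \<cdot>\<^sub>v row G i) {..<k1} $ l +
      finsum_vec TYPE('a dual_number) ?n (\<lambda>j. base (b $ j) \<cdot>\<^sub>v row G (k1 + j)) {..<k2} $ l"
    by (auto simp: generator_sum_def)
  show "dim_vec (generator_sum k1 k2 G a b) = dim_vec (transpose_mat G *\<^sub>v ?c)"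
    using dim by simp
  fix l assume "l < dim_vec (transpose_mat G *\<^sub>v ?c)"
  then have l: "l < ?n" by simp
  have split: "(\<Sum>i<k1 + m. f i) = (\<Sum>i<k1. f i) + (\<Sum>j<m. f (k1 + j))"
    for f :: "nat \<Rightarrow> 'a dual_number" and m
    by (induction m) (simp_all add: add.assoc)
  have s1: "finsum_vec TYPE('a dual_number) ?n (\<lambda>i. a $ i \<cdot>\<^sub>v row G i) {..<k1} $ l =
      (\<Sum>i<k1. G $$ (i, l) * ?c $ i)"
    by (subst index_finsum_vec) (use l G a b in \<open>auto simp: mult.commute intro!: sum.cong\<close>)
  have s2: "finsum_vec TYPE('a dual_number) ?n (\<lambda>j. base (b $ j) \<cdot>\<^sub>v row G (k1 + j)) {..<k2} $ l =
      (\<Sum>j<k2. G $$ (k1 + j, l) * ?c $ (k1 + j))"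
    by (subst index_finsum_vec) (use l G a b in \<open>auto simp: mult.commute intro!: sum.cong\<close>)
  have "generator_sum k1 k2 G a b $ l = (\<Sum>i<k1 + k2. G $$ (i, l) * ?c $ i)"
    unfolding ix[OF l] s1 s2 split ..
  also have "\<dots> = (transpose_mat G *\<^sub>v ?c) $ l"
    using l G a b by (simp add: scalar_prod_def atLeast0LessThan)
  finally show "generator_sum k1 k2 G a b $ l = (transpose_mat G *\<^sub>v ?c) $ l" .
qed

lemma generator_matrix_factor:
  assumes G: "generator_matrix n C G" and H: "dim_col H = n" "set (rows H) \<subseteq> C"
  shows "\<exists>M \<in> carrier_mat (dim_row H) (dim_row G). H = M * G"
proof -
  have "\<exists>w \<in> carrier_vec (dim_row G). c = transpose_mat G *\<^sub>v w" if c: "c \<in> C" for c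
  proof -
    obtain k1 k2 where k: "dim_row G = k1 + k2"
      and ex: "\<forall>c\<in>C. \<exists>!p. p \<in> carrier_vec k1 \<times> carrier_vec k2 \<and>
           c = generator_sum k1 k2 G (fst p) (snd p)"
      using G unfolding generator_matrix_def by metis
    obtain p where p: "p \<in> carrier_vec k1 \<times> carrier_vec k2 \<and>
           c = generator_sum k1 k2 G (fst p) (snd p)"
      using ex1_implies_ex[OF bspec[OF ex c]] by (elim exE)
    define a b where "a = fst p" and "b = snd p"
    have ab: "a \<in> carrier_vec k1" "b \<in> carrier_vec k2" and "c = generator_sum k1 k2 G a b"
      using p by (auto simp: a_def b_def)
    then have "c = transpose_mat G *\<^sub>v (a @\<^sub>v map_vec base b)"
      using generator_sum_eq[OF k] by simp
    then show ?thesis using ab k by (intro bexI[of _ "a @\<^sub>v map_vec base b"]) auto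
  qed
  then have "\<forall>i. \<exists>w. i < dim_row H \<longrightarrow> w \<in> carrier_vec (dim_row G) \<and> row H i = transpose_mat G *\<^sub>v w"
    using H(2) by (metis in_set_conv_nth length_rows nth_rows subsetD)
  then obtain w where w: "\<And>i. i < dim_row H \<Longrightarrow> w i \<in> carrier_vec (dim_row G)"
    "\<And>i. i < dim_row H \<Longrightarrow> row H i = transpose_mat G *\<^sub>v w i"
    by metis
  define M where "M = mat (dim_row H) (dim_row G) (\<lambda>(i, j). w i $ j)"
  have M: "M \<in> carrier_mat (dim_row H) (dim_row G)" by (simp add: M_def)
  have "H = M * G"
  proof (rule eq_matI)
    fix i j assume "i < dim_row (M * G)" "j < dim_col (M * G)"
    then have i: "i < dim_row H" and j: "j < dim_col G" by (simp_all add: M_def)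
    have "row H i $ j = col G j \<bullet> w i" using w(2)[OF i] j by simp
    also have "\<dots> = row M i \<bullet> col G j"
      using w(1)[OF i] i by (auto simp: M_def scalar_prod_def mult.commute intro!: sum.cong)
    finally show "H $$ (i, j) = (M * G) $$ (i, j)"
      using i j H(1) G M by (simp add: generator_matrix_def)
  qed (use G H M in \<open>auto simp: generator_matrix_def\<close>)
  with M show ?thesis by blast
qed

lemma generator_matrix_unique:
  fixes G :: "'a::field dual_number mat"
  assumes G: "generator_matrix n C G" and C: "0\<^sub>v n \<in> C"
    and w: "w \<in> carrier_vec (dim_row G)" "transpose_mat G *\<^sub>v w = 0\<^sub>v n" and i: "i < dim_row G"
  shows "part0 (w $ i) = 0"
proof -
  have n: "dim_col G = n" using G by (simp add: generator_matrix_def)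
  obtain k1 k2 where k: "dim_row G = k1 + k2"
    and uv: "\<forall>j<k2. row G (k1 + j) \<in> uvecs n"
    and ex: "\<forall>c\<in>C. \<exists>!p. p \<in> carrier_vec k1 \<times> carrier_vec k2 \<and>
           c = generator_sum k1 k2 G (fst p) (snd p)"
    using G unfolding generator_matrix_def by metis
  define a where "a = vec k1 (\<lambda>i. w $ i)"
  define b where "b = vec k2 (\<lambda>j. part0 (w $ (k1 + j)))"
  have ab: "a \<in> carrier_vec k1" "b \<in> carrier_vec k2" by (simp_all add: a_def b_def)
  have "transpose_mat G *\<^sub>v (a @\<^sub>v map_vec base b) = transpose_mat G *\<^sub>v w"
  proof (rule eq_vecI)
    fix l assume "l < dim_vec (transpose_mat G *\<^sub>v w)"
    then have l: "l < n" using n by simp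
    have "G $$ (i, l) * (a @\<^sub>v map_vec base b) $ i = G $$ (i, l) * w $ i" if "i < k1 + k2" for i
    proof (cases "i < k1")
      case True
      then show ?thesis using ab by (simp add: a_def)
    next
      case False
      define j where "j = i - k1"
      have j: "i = k1 + j" "j < k2" using False that by (auto simp: j_def)
      have "G $$ (i, l) \<in> range ((*) u)"
        using uv[rule_format, OF j(2)] l j k n by (auto simp: uvecs_def)
      then have "part0 (G $$ (i, l)) = 0" by auto
      then show ?thesis using j ab by (simp add: b_def a_def dual_number_eq_iff)
    qed
    then show "(transpose_mat G *\<^sub>v (a @\<^sub>v map_vec base b)) $ l = (transpose_mat G *\<^sub>v w) $ l"
      using l n k w(1) ab by (auto simp: scalar_prod_def intro!: sum.cong)
  qed simp
  then have s1: "0\<^sub>v n = generator_sum k1 k2 G a b"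
    using w(2) generator_sum_eq[OF k ab] by simp
  have b0: "base (0::'a) = 0" by (simp add: dual_number_eq_iff)
  have "generator_sum k1 k2 G (0\<^sub>v k1) (0\<^sub>v k2)
      = transpose_mat G *\<^sub>v (0\<^sub>v k1 @\<^sub>v map_vec base (0\<^sub>v k2))"
    by (rule generator_sum_eq[OF k]) simp_all
  also have "(0\<^sub>v k1 @\<^sub>v map_vec base (0\<^sub>v k2 :: 'a vec)) = 0\<^sub>v (k1 + k2)"
    by (rule eq_vecI) (auto simp: b0)
  also have "transpose_mat G *\<^sub>v 0\<^sub>v (k1 + k2) = 0\<^sub>v n"
    by (rule eq_vecI) (use k n in \<open>auto simp: scalar_prod_def\<close>)
  finally have s2: "0\<^sub>v n = generator_sum k1 k2 G (0\<^sub>v k1) (0\<^sub>v k2)" by simp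
  have "(a, b) = (0\<^sub>v k1, 0\<^sub>v k2)"
    by (rule ex1E[OF bspec[OF ex C]]) (use s1 s2 ab in \<open>metis SigmaI fst_conv snd_conv zero_carrier_vec\<close>)
  then have a0: "a = 0\<^sub>v k1" and b0: "b = 0\<^sub>v k2" by auto
  show ?thesis
  proof (cases "i < k1")
    case True
    then have "w $ i = a $ i" by (simp add: a_def)
    then show ?thesis using True a0 by simp
  next
    case False
    then have "k1 + (i - k1) = i" by simp
    then have "part0 (w $ i) = b $ (i - k1)" using i k False by (simp add: b_def del: le_add_diff_inverse)
    then show ?thesis using False i k b0 by simp
  qed
qed

lemma row_span_mult_subset:
  fixes B :: "'a::field dual_number mat"
  assumes M: "M \<in> carrier_mat k (dim_row B)"
  shows "row_span (M * B) \<subseteq> row_span B"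
proof -
  interpret V: vec_module "TYPE('a dual_number)" "dim_col B" .
  have rB: "set (rows B) \<subseteq> carrier_vec (dim_col B)" by (auto simp: rows_def)
  have "row (M * B) i \<in> V.span (set (rows B))" if i: "i < k" for i
  proof -
    have rM: "row M i \<in> carrier_vec (dim_row B)" using M by (metis carrier_matD(2) carrier_vecI index_row(2))
    have "row (M * B) i = transpose_mat B *\<^sub>v row M i"
      using M i rM by (intro eq_vecI) (auto intro: comm_scalar_prod[of _ "dim_row B"])
    also have "transpose_mat B = mat_of_cols (dim_col B) (rows B)"
      by (rule eq_matI) (auto simp: mat_of_cols_index)
    also have "\<dots> *\<^sub>v row M i \<in> V.span (set (rows B))"
      by (subst V.mat_of_rows_mult_as_finsum) (use rM rB in \<open>auto simp: V.span_def\<close>)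
    finally show ?thesis .
  qed
  then have "set (rows (M * B)) \<subseteq> V.span (set (rows B))"
    using M by (auto simp: rows_def)
  from V.span_is_subset[OF this V.span_is_submodule[OF rB]] show ?thesis
    using M by (simp add: row_span_def)
qed

lemma append_cols_mult:
  assumes "M \<in> carrier_mat k l" "A \<in> carrier_mat l n" "D \<in> carrier_mat l m"
  shows "append_cols (M * A) (M * D) = M * append_cols A D"
  by (rule eq_matI) (use assms in \<open>auto simp: append_cols_def scalar_prod_def\<close>)

lemma lcd_embedding_iff:
  fixes C :: "'a::field dual_number vec set"
  assumes C: "linear_code n C" and G: "generator_matrix n C G"
  shows "lcd_embedding n C N E \<longleftrightarrow> lcd_code N E \<and>
    (\<exists>m D. D \<in> carrier_mat (dim_row G) m \<and> N = n + m \<and> E = row_span (append_cols G D))"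
proof
  assume "lcd_embedding n C N E"
  then obtain H m D where lcd: "lcd_code N E" and H: "generator_matrix n C H"
    and D: "D \<in> carrier_mat (dim_row H) m" and N: "N = n + m" and E: "E = row_span (append_cols H D)"
    unfolding lcd_embedding_def by blast
  define k l where "k = dim_row G" and "l = dim_row H"
  have Gc: "G \<in> carrier_mat k n" "dim_col G = n" "set (rows G) \<subseteq> C" and Hc: "H \<in> carrier_mat l n" "dim_col H = n" "set (rows H) \<subseteq> C"
    using conjunct1[OF G[unfolded generator_matrix_def]] conjunct1[OF H[unfolded generator_matrix_def]]
      conjunct1[OF conjunct2[OF G[unfolded generator_matrix_def]]]
      conjunct1[OF conjunct2[OF H[unfolded generator_matrix_def]]]
    by (auto simp: k_def l_def)
  have C0: "0\<^sub>v n \<in> C"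
    using submodule.zero_closed[OF C[unfolded linear_code_def]] by (simp add: module_vec_simps)
  obtain P where P: "P \<in> carrier_mat k l" and GP: "G = P * H"
    using generator_matrix_factor[OF H, of G] Gc unfolding k_def l_def by blast
  obtain Q where Q: "Q \<in> carrier_mat l k" and HQ: "H = Q * G"
    using generator_matrix_factor[OF G, of H] Hc unfolding k_def l_def by blast
  define X where "X = Q * P - 1\<^sub>m l"
  have X: "X \<in> carrier_mat l l" unfolding X_def by (rule minus_carrier_mat) simp
  have QPH: "Q * P * H = H" using HQ GP P Q Hc by (metis assoc_mult_mat)
  then have XH: "X * H = 0\<^sub>m l n"
    using minus_mult_distrib_mat[of "Q * P" l l "1\<^sub>m l" H n] P Q Hc by (simp add: X_def)
  have X0: "part0 (X $$ (i, j)) = 0" if i: "i < l" and j: "j < l" for i j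
  proof -
    have "transpose_mat H *\<^sub>v row X i = row (X * H) i"
      using X Hc i by (intro eq_vecI) (auto intro: comm_scalar_prod[of _ l])
    also have "\<dots> = 0\<^sub>v n" using XH i by simp
    finally have rX: "transpose_mat H *\<^sub>v row X i = 0\<^sub>v n" .
    have "row X i \<in> carrier_vec (dim_row H)" using X i l_def by (metis row_carrier_vec)
    from generator_matrix_unique[OF H C0 this rX] have "part0 (row X i $ j) = 0"
      using j by (simp add: l_def)
    then show ?thesis using i j X by simp
  qed
  have XX: "X * X = 0\<^sub>m l l"
  proof (rule eq_matI)
    fix i j assume "i < dim_row (0\<^sub>m l l)" "j < dim_col (0\<^sub>m l l)"
    then have i: "i < l" and j: "j < l" by simp_all
    have "(X * X) $$ (i, j) = (\<Sum>s = 0..<l. X $$ (i, s) * X $$ (s, j))"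
      using X i j by (simp add: scalar_prod_def)
    also have "\<dots> = 0"
      by (rule sum.neutral) (use X0 i j in \<open>simp add: dual_number_eq_iff\<close>)
    finally show "(X * X) $$ (i, j) = 0\<^sub>m l l $$ (i, j)" using i j by simp
  qed (use X in auto)
  have inv: "(1\<^sub>m l - X) * (Q * P) = 1\<^sub>m l"
  proof -
    have QP: "Q * P = 1\<^sub>m l + X" using P Q by (auto simp: X_def)
    have "(1\<^sub>m l - X) * (1\<^sub>m l + X) = (1\<^sub>m l + X) - X * (1\<^sub>m l + X)"
      using minus_mult_distrib_mat[of "1\<^sub>m l" l l X "1\<^sub>m l + X" l] X by simp
    also have "X * (1\<^sub>m l + X) = X"
      using mult_add_distrib_mat[of X l l "1\<^sub>m l" l X] X XX by simp
    also have "(1\<^sub>m l + X) - X = 1\<^sub>m l" using X by auto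
    finally show ?thesis by (simp add: QP)
  qed
  let ?A = "append_cols H D"
  have D: "D \<in> carrier_mat l m" using D by (simp add: l_def)
  have A: "?A \<in> carrier_mat l (n + m)"
    using four_block_carrier_mat[OF Hc(1), of "0\<^sub>m 0 (dim_col D)" 0 m] D
    by (simp add: append_cols_def)
  have GPD: "append_cols G (P * D) = P * ?A"
    unfolding GP by (rule append_cols_mult[OF P Hc(1) D])
  define Y where "Y = 1\<^sub>m l - X"
  have Y: "Y \<in> carrier_mat l l" unfolding Y_def by (rule minus_carrier_mat[OF X])
  have S: "Y * Q \<in> carrier_mat l k" using Y Q by simp
  have "Y * Q * (P * ?A) = Y * Q * P * ?A"
    using assoc_mult_mat[OF S P A] by simp
  also have "Y * Q * P = Y * (Q * P)"
    by (rule assoc_mult_mat[OF Y Q P])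
  also have "\<dots> * ?A = ?A" using inv A by (simp add: Y_def)
  finally have "row_span ?A \<subseteq> row_span (P * ?A)"
    using row_span_mult_subset[of "Y * Q" l "P * ?A"] S P by simp
  moreover have "row_span (P * ?A) \<subseteq> row_span ?A"
    by (rule row_span_mult_subset) (use P A in auto)
  ultimately have "E = row_span (append_cols G (P * D))"
    unfolding E GPD by blast
  moreover have "P * D \<in> carrier_mat (dim_row G) m" using P D by (simp add: k_def)
  ultimately show "lcd_code N E \<and>
    (\<exists>m D. D \<in> carrier_mat (dim_row G) m \<and> N = n + m \<and> E = row_span (append_cols G D))"
    using lcd N by blast
next
  assume "lcd_code N E \<and>
    (\<exists>m D. D \<in> carrier_mat (dim_row G) m \<and> N = n + m \<and> E = row_span (append_cols G D))"
  then obtain m D where "lcd_code N E" "D \<in> carrier_mat (dim_row G) m" "N = n + m"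
    "E = row_span (append_cols G D)" by auto
  with G show "lcd_embedding n C N E"
    unfolding lcd_embedding_def by (intro conjI exI[of _ G] exI[of _ m] exI[of _ D])
qed

definition min_lcd_embedding_length :: "nat \<Rightarrow> 'a::field dual_number vec set \<Rightarrow> nat" where
  "min_lcd_embedding_length n C = (LEAST N. \<exists>E. lcd_embedding n C N E)"

end

theory Submission
  imports Defs
begin

text \<open>
  Let $B = [G \mid D]$, and let $B_0$, $D_0$ be the residues of $B$, $D$ modulo $u$. The code
  generated by $B$ is LCD iff the residue $A_0 + D_0 D_0^T$ of $B B^T$ is invertible. For
  necessity, LCD means that $B B^T w = 0$ implies $B^T w = 0$. If $v \neq 0$ is in the kernel of
  the symmetric residue $M_0$ of $B B^T = M_0 + u M_1$, then $M_1 v$ is orthogonal to that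
  kernel, so $M_0 z = M_1 v$ has a solution $z$, and $w = v - u z$ satisfies $B B^T w = 0$.
  But $B^T w = 0$ contradicts the uniqueness of representations with respect to $G$.

  It remains to find the least number $m$ of columns of $D_0$ for which $A_0 + D_0 D_0^T$ is
  invertible. Subadditivity of the rank gives $m \geq k - r$. Conversely, if $M$ is symmetric and
  singular with $M v = 0$, $v_i \neq 0$, then adding $e_i e_i^T$ enlarges the column space of $M$;
  so $k - r$ unit vectors suffice in every characteristic. The same update step yields,
  by induction, the solvability criterion for symmetric systems used above.
\<close>

section \<open>Comparing matrix ranks through column spaces\<close>

context vec_space
begin

lemma rank_le_col_spaceI:
  assumes A: "A \<in> carrier_mat n nc" and B: "B \<in> carrier_mat n nc'"
    and sub: "set (cols A) \<subseteq> col_space B"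
  shows "rank A \<le> rank B"
proof -
  have cA: "set (cols A) \<subseteq> carrier_vec n" and cB: "set (cols B) \<subseteq> carrier_vec n"
    using A B cols_dim by blast+
  have sB: "subspace class_ring (span (set (cols B))) V"
    using span_is_subspace[OF cB[folded module_vec_simps(3)]] .
  have sA: "subspace class_ring (span (set (cols A))) V"
    using span_is_subspace[OF cA[folded module_vec_simps(3)]] .
  have "span (set (cols A)) \<subseteq> span (set (cols B))"
    using span_is_subset[OF sub[unfolded col_space_def] span_is_submodule] cB by simp
  then have "subspace class_ring (span (set (cols A))) (span_vs (set (cols B)))"
    using nested_subspaces[OF sB sA] by simp
  then show ?thesis
    unfolding rank_def
    using vectorspace.subspace_dim[OF subspace_is_vs[OF sB]] fin_dim_span_cols[OF A] fin_dim_span_cols[OF B]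
    by simp
qed

text \<open>A basis of the column space of \<open>A\<close> chosen among its columns stays
  independent when \<open>y\<close> is adjoined, and all of these vectors lie in the column space of
  \<open>B\<close>.\<close>

lemma rank_less_col_spaceI:
  assumes A: "A \<in> carrier_mat n nc" and B: "B \<in> carrier_mat n nc'"
    and sub: "set (cols A) \<subseteq> col_space B" and y: "y \<in> col_space B" "y \<notin> col_space A"
  shows "rank A < rank B"
proof -
  have cA: "set (cols A) \<subseteq> carrier_vec n" and cB: "set (cols B) \<subseteq> carrier_vec n"
    using A B cols_dim by blast+
  have yc: "y \<in> carrier_vec n"
    using y(1) B by (auto simp: col_space_eq[OF B])
  obtain S where S: "maximal S (\<lambda>T. T \<subseteq> set (cols A) \<and> lin_indpt T)"
    using maximal_exists_superset[of "set (cols A)" "\<lambda>T. T \<subseteq> set (cols A) \<and> lin_indpt T" "{}"]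
    by (auto simp: lin_dep_def)
  then have SA: "S \<subseteq> set (cols A)" and li: "lin_indpt S" by (auto simp: maximal_def)
  have yspan: "y \<notin> span S"
    using y(2) span_is_monotone[OF SA] by (auto simp: col_space_def)
  have SV: "S \<subseteq> carrier_vec n"
    using subset_trans[OF SA cA] .
  have yS: "y \<notin> S"
    using yspan subsetD[OF in_own_span[OF SV]] by (rule contrapos_nn)
  have liy: "lin_indpt (insert y S)"
    using lin_dep_iff_in_span[OF SV li yc yS] yspan by simp
  \<comment> \<open>\<open>rank_ge_card_indpt\<close> speaks of columns of a matrix, so
    \<open>y\<close> is made a column; the set \<open>insert y S\<close> then bounds the rank of
    \<open>A'\<close> from below.\<close>
  define A' where "A' = mat_of_cols n (cols A @ [y])"
  have cols: "cols A' = cols A @ [y]"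
    unfolding A'_def by (rule cols_mat_of_cols) (use cA yc in auto)
  have A': "A' \<in> carrier_mat n (Suc nc)" using A mat_of_cols_carrier(1)[of n "cols A @ [y]"] by (simp add: A'_def)
  have "rank A = card S" by (rule rank_card_indpt[OF A S])
  also have "\<dots> < card (insert y S)" using yS finite_subset[OF SA] by simp
  also have "\<dots> \<le> rank A'"
    by (rule rank_ge_card_indpt[OF A' _ liy]) (use SA cols in auto)
  also have "\<dots> \<le> rank B"
    by (rule rank_le_col_spaceI[OF A' B]) (use sub y(1) cols in auto)
  finally show ?thesis .
qed

lemma mult_mat_vec_in_col_space:
  assumes "A \<in> carrier_mat n nc" "x \<in> carrier_vec nc"
  shows "A *\<^sub>v x \<in> col_space A"
  using assms by (auto simp: col_space_eq[OF assms(1)])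

text \<open>Every column of \<open>X * Y\<close> is \<open>X\<close> applied to a column of
  \<open>Y\<close>, so the rank is at most that of \<open>X\<close>, which has only \<open>m\<close>
  columns.\<close>

lemma rank_mult_le_inner_dim:
  assumes X: "X \<in> carrier_mat n m" and Y: "Y \<in> carrier_mat m nc"
  shows "rank (X * Y) \<le> m"
proof -
  have XY: "X * Y \<in> carrier_mat n nc" using X Y by simp
  have "set (cols (X * Y)) \<subseteq> col_space X"
  proof
    fix c assume "c \<in> set (cols (X * Y))"
    then obtain j where j: "j < nc" "c = col (X * Y) j"
      using XY by (metis carrier_matD(2) cols_length cols_nth in_set_conv_nth)
    then have "c = X *\<^sub>v col Y j" using col_mult2[OF X Y j(1)] by simp
    then show "c \<in> col_space X"
      using mult_mat_vec_in_col_space[OF X] col_dim[of Y j] Y by simp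
  qed
  from rank_le_col_spaceI[OF XY X this] rank_le_nc[OF X] show ?thesis by simp
qed

end

section \<open>Rank-one updates \<open>d d^T\<close> of symmetric matrices\<close>

definition outer :: "'a::semiring_0 vec \<Rightarrow> 'a mat" where
  "outer d = mat (dim_vec d) (dim_vec d) (\<lambda>(i, j). d $ i * d $ j)"

lemma outer_carrier: "d \<in> carrier_vec k \<Longrightarrow> outer d \<in> carrier_mat k k"
  by (simp add: outer_def)

lemma transpose_outer: "transpose_mat (outer d) = outer (d :: 'a::comm_semiring_0 vec)"
  by (rule eq_matI) (auto simp: outer_def mult.commute)

lemma symmetric_add_outer:
  fixes M :: "'a::comm_semiring_0 mat"
  assumes "M \<in> carrier_mat k k" "transpose_mat M = M" "d \<in> carrier_vec k"
  shows "M + outer d \<in> carrier_mat k k" "transpose_mat (M + outer d) = M + outer d"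
  using assms outer_carrier[OF assms(3)] by (simp_all add: transpose_add transpose_outer)

lemma outer_mult_vec:
  fixes d :: "'a::comm_semiring_0 vec"
  assumes "d \<in> carrier_vec k" "x \<in> carrier_vec k"
  shows "outer d *\<^sub>v x = (d \<bullet> x) \<cdot>\<^sub>v d"
  by (rule eq_vecI)
    (use assms in \<open>auto simp: outer_def scalar_prod_def sum_distrib_right sum_distrib_left ac_simps intro!: sum.cong\<close>)

lemma symmetric_mat_scalar_prod:
  fixes M :: "'a::comm_ring_1 mat"
  assumes M: "M \<in> carrier_mat k k" "transpose_mat M = M"
    and "x \<in> carrier_vec k" "y \<in> carrier_vec k"
  shows "x \<bullet> (M *\<^sub>v y) = (M *\<^sub>v x) \<bullet> y"
  using transpose_vec_mult_scalar[of M k k y x] assms by (metis)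

text \<open>Symmetry makes the column space of \<open>M\<close> orthogonal to its kernel vector
  \<open>v\<close>, so any \<open>d\<close> with \<open>v . d\<close> nonzero lies outside it; the
  update gains this direction and loses none. Both vectors are returned because
  \<open>symmetric_Fredholm\<close> works with the pairing \<open>v . d\<close>.\<close>

lemma singular_symmetric_update:
  fixes M :: "'a::field mat"
  assumes M: "M \<in> carrier_mat k k" and sym: "transpose_mat M = M" and det: "det M = 0"
  obtains v d where "v \<in> carrier_vec k" "d \<in> carrier_vec k" "M *\<^sub>v v = 0\<^sub>v k" "v \<bullet> d \<noteq> 0"
    "vec_space.rank k M < vec_space.rank k (M + outer d)"
proof -
  interpret vec_space "TYPE('a)" k .
  obtain v where v: "v \<in> carrier_vec k" "v \<noteq> 0\<^sub>v k" "M *\<^sub>v v = 0\<^sub>v k"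
    using det det_0_iff_vec_prod_zero_field[OF M] by blast
  then obtain i where i: "i < k" "v $ i \<noteq> 0"
    by (metis carrier_vecD eq_vecI index_zero_vec(1,2))
  \<comment> \<open>Taking \<open>d = v\<close> could fail, since \<open>v\<close> may be orthogonal
    to itself; a unit vector at a nonzero entry of \<open>v\<close> always works.\<close>
  define d :: "'a vec" where "d = unit_vec k i"
  have d: "d \<in> carrier_vec k" and vd: "v \<bullet> d \<noteq> 0" and dv: "d \<bullet> v \<noteq> 0"
    using v i by (simp_all add: d_def)
  let ?N = "M + outer d"
  have N: "?N \<in> carrier_mat k k" using M outer_carrier[OF d] by simp
  have Nx: "?N *\<^sub>v x = M *\<^sub>v x + (d \<bullet> x) \<cdot>\<^sub>v d" if "x \<in> carrier_vec k" for x
    using that M d outer_carrier[OF d] by (simp add: add_mult_distrib_mat_vec outer_mult_vec)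
  have colN: "?N *\<^sub>v x \<in> col_space ?N" if "x \<in> carrier_vec k" for x
    using mult_mat_vec_in_col_space[OF N that] .
  have "?N *\<^sub>v (inverse (d \<bullet> v) \<cdot>\<^sub>v v) = d"
    using v d dv M N by (simp add: Nx mult_mat_vec[OF M] smult_smult_assoc)
  then have dN: "d \<in> col_space ?N"
    using colN[of "inverse (d \<bullet> v) \<cdot>\<^sub>v v"] v(1) by simp
  have "d \<noteq> M *\<^sub>v x" if x: "x \<in> carrier_vec k" for x
    using symmetric_mat_scalar_prod[OF M sym v(1) x] v vd x by auto
  then have dM: "d \<notin> col_space M"
    using M by (auto simp: col_space_eq[OF M])
  have "set (cols M) \<subseteq> col_space ?N"
  proof
    fix c assume "c \<in> set (cols M)"
    then obtain j where j: "j < k" "c = col M j"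
      using M by (metis carrier_matD(2) cols_length cols_nth in_set_conv_nth)
    \<comment> \<open>Subtracting this multiple of \<open>v\<close> makes \<open>x\<close>
      orthogonal to \<open>d\<close>, so the update vanishes on \<open>x\<close>, while
      \<open>M\<close> still sends \<open>x\<close> to its column \<open>j\<close> because it kills
      \<open>v\<close>.\<close>
    define x where "x = unit_vec k j - (d \<bullet> unit_vec k j * inverse (d \<bullet> v)) \<cdot>\<^sub>v v"
    have x: "x \<in> carrier_vec k" using v by (simp add: x_def)
    have "d \<bullet> x = 0" using d v dv by (simp add: x_def scalar_prod_minus_distrib[of _ k])
    moreover have "M *\<^sub>v unit_vec k j = c"
      by (rule eq_vecI) (use M j in auto)
    then have "M *\<^sub>v x = c"
      using M v j by (simp add: x_def mult_minus_distrib_mat_vec[OF M] mult_mat_vec[OF M])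
    ultimately have "?N *\<^sub>v x = c" using Nx[OF x] d M j by auto
    with colN[OF x] show "c \<in> col_space ?N" by simp
  qed
  from rank_less_col_spaceI[OF M N this dN dM] show ?thesis
    using that v d vd by blast
qed

text \<open>Induction on \<open>m\<close>: as long as the matrix is singular, one more column of
  \<open>D\<close> raises its rank by at least one. Once it is nonsingular, the remaining columns
  are filled with zeros.\<close>

lemma exists_nonsingular_gram_update:
  fixes M :: "'a::field mat"
  assumes "M \<in> carrier_mat k k" "transpose_mat M = M" "k \<le> vec_space.rank k M + m"
  shows "\<exists>D \<in> carrier_mat k m. det (M + D * transpose_mat D) \<noteq> 0"
  using assms
proof (induction m arbitrary: M)
  case 0
  interpret vec_space "TYPE('a)" k .
  have "det M \<noteq> 0" using 0 det_rank_iff rank_le_nc by (metis add.right_neutral le_antisym)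
  moreover have "M + 0\<^sub>m k 0 * transpose_mat (0\<^sub>m k 0) = M"
    by (rule eq_matI) (use 0 in auto)
  ultimately show ?case by (intro bexI[of _ "0\<^sub>m k 0"]) auto
next
  case (Suc m)
  show ?case
  proof (cases "det M = 0")
    case False
    moreover have "M + 0\<^sub>m k (Suc m) * transpose_mat (0\<^sub>m k (Suc m)) = M"
      by (rule eq_matI) (use Suc in auto)
    ultimately show ?thesis by (intro bexI[of _ "0\<^sub>m k (Suc m)"]) auto
  next
    case True
    from singular_symmetric_update[OF Suc.prems(1,2) True] obtain d where d: "d \<in> carrier_vec k"
      and rank: "vec_space.rank k M < vec_space.rank k (M + outer d)" by metis
    have "M + outer d \<in> carrier_mat k k" "transpose_mat (M + outer d) = M + outer d"
      by (fact symmetric_add_outer[OF Suc.prems(1,2) d])+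
    moreover have "k \<le> vec_space.rank k (M + outer d) + m" using rank Suc.prems(3) by linarith
    ultimately obtain D where D: "D \<in> carrier_mat k m"
      and det: "det (M + outer d + D * transpose_mat D) \<noteq> 0"
      using Suc.IH by blast
    \<comment> \<open>The vector \<open>d\<close> becomes the last column, so that
      \<open>D' D'^T = D D^T + d d^T\<close>.\<close>
    define D' where "D' = mat k (Suc m) (\<lambda>(i, j). if j < m then D $$ (i, j) else d $ i)"
    have "M + D' * transpose_mat D' = M + outer d + D * transpose_mat D"
      by (rule eq_matI)
        (use Suc.prems(1) D d in \<open>auto simp: D'_def outer_def scalar_prod_def\<close>)
    with det show ?thesis by (intro bexI[of _ D']) (auto simp: D'_def)
  qed
qed

text \<open>Induction on the corank, which \<open>singular_symmetric_update\<close> lowers. The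
  condition on \<open>b\<close> passes from \<open>M\<close> to \<open>M + outer d\<close>, and a
  solution for the updated matrix already solves the original system.\<close>

lemma symmetric_Fredholm:
  fixes M :: "'a::field mat"
  assumes "M \<in> carrier_mat k k" "transpose_mat M = M" "b \<in> carrier_vec k"
    and "\<And>v. v \<in> carrier_vec k \<Longrightarrow> M *\<^sub>v v = 0\<^sub>v k \<Longrightarrow> v \<bullet> b = 0"
  shows "\<exists>x \<in> carrier_vec k. M *\<^sub>v x = b"
  using assms
proof (induction "k - vec_space.rank k M" arbitrary: M rule: less_induct)
  case less
  interpret vec_space "TYPE('a)" k .
  note M = less.prems(1)
  show ?case
  proof (cases "det M = 0")
    case False
    then obtain X where X: "X \<in> carrier_mat k k" "M * X = 1\<^sub>m k"
      \<comment> \<open>\<open>undefined\<close> fills the record extension of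
        \<open>ring_mat\<close>, which does not affect its units.\<close>
      using det_non_zero_imp_unit[OF M, of undefined] by (auto simp: Units_def ring_mat_def)
    then have "M *\<^sub>v (X *\<^sub>v b) = b"
      using M less.prems(3) by (metis assoc_mult_mat_vec one_mult_mat_vec)
    with X less.prems(3) show ?thesis by (intro bexI[of _ "X *\<^sub>v b"]) auto
  next
    case True
    from singular_symmetric_update[OF M less.prems(2) True] obtain v d
      where v: "v \<in> carrier_vec k" "M *\<^sub>v v = 0\<^sub>v k" and d: "d \<in> carrier_vec k"
        and vd: "v \<bullet> d \<noteq> 0" and rank: "rank M < rank (M + outer d)" by metis
    let ?N = "M + outer d"
    have N: "?N \<in> carrier_mat k k" "transpose_mat ?N = ?N"
      by (fact symmetric_add_outer[OF less.prems(1,2) d])+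
    have Nx: "?N *\<^sub>v x = M *\<^sub>v x + (d \<bullet> x) \<cdot>\<^sub>v d" if "x \<in> carrier_vec k" for x
      using that M d outer_carrier[OF d] by (simp add: add_mult_distrib_mat_vec outer_mult_vec)
    have vN: "v \<bullet> (?N *\<^sub>v x) = (d \<bullet> x) * (v \<bullet> d)" if x: "x \<in> carrier_vec k" for x
      using symmetric_mat_scalar_prod[OF M less.prems(2) v(1) x] x v d M
      by (simp add: Nx scalar_prod_add_distrib[of _ k])
    \<comment> \<open>Pairing with \<open>v\<close> removes \<open>M\<close>, so
      \<open>v . N x = 0\<close> forces \<open>d . x = 0\<close>, and for such \<open>x\<close> the
      matrices \<open>N\<close> and \<open>M\<close> agree. This applies to kernel vectors of
      \<open>N\<close> and, as \<open>v . b = 0\<close>, to solutions of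
      \<open>N x = b\<close>.\<close>
    have drop: "?N *\<^sub>v x = M *\<^sub>v x" if x: "x \<in> carrier_vec k" and "v \<bullet> (?N *\<^sub>v x) = 0" for x
      using vN[OF x] that(2) vd Nx[OF x] d M x by auto
    have "w \<bullet> b = 0" if w: "w \<in> carrier_vec k" "?N *\<^sub>v w = 0\<^sub>v k" for w
      using drop[OF w(1)] w v less.prems(4)[OF w(1)] by simp
    \<comment> \<open>The truncated difference drops strictly because the new rank is still at most
      \<open>k\<close>.\<close>
    moreover have "k - rank ?N < k - rank M" using rank rank_le_nc[OF N(1)] by linarith
    ultimately obtain x where x: "x \<in> carrier_vec k" "?N *\<^sub>v x = b"
      using less.hyps[OF _ N less.prems(3)] by blast
    with drop[OF x(1)] less.prems(4)[OF v] show ?thesis by auto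
  qed
qed

section \<open>Residues and u-parts of vectors and matrices\<close>

lemma part_sum:
  "part0 (sum f S) = (\<Sum>i\<in>S. part0 (f i))" "part1 (sum f S) = (\<Sum>i\<in>S. part1 (f i))"
  by (induction S rule: infinite_finite_induct) simp_all

lemma map_part_zero_vec:
  "map_vec part0 (0\<^sub>v n) = 0\<^sub>v n" "map_vec part1 (0\<^sub>v n) = 0\<^sub>v n"
  by (auto simp: vec_eq_iff)

lemma part_scalar_prod:
  assumes "x \<in> carrier_vec n" "y \<in> carrier_vec n"
  shows "part0 (x \<bullet> y) = map_vec part0 x \<bullet> map_vec part0 y"
    and "part1 (x \<bullet> y) = map_vec part0 x \<bullet> map_vec part1 y + map_vec part1 x \<bullet> map_vec part0 y"
  using assms by (simp_all add: scalar_prod_def part_sum sum.distrib)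

lemma part_mult_mat_vec:
  assumes "A \<in> carrier_mat nr nc" "w \<in> carrier_vec nc"
  shows "map_vec part0 (A *\<^sub>v w) = map_mat part0 A *\<^sub>v map_vec part0 w"
    and "map_vec part1 (A *\<^sub>v w) =
      map_mat part0 A *\<^sub>v map_vec part1 w + map_mat part1 A *\<^sub>v map_vec part0 w"
  by (rule eq_vecI; use assms in \<open>simp add: scalar_prod_def part_sum sum.distrib\<close>)+

definition dual_vec :: "'a vec \<Rightarrow> 'a vec \<Rightarrow> 'a dual_number vec" where
  "dual_vec x y = vec (dim_vec x) (\<lambda>i. DN (x $ i) (y $ i))"

lemma dual_vec_carrier: "x \<in> carrier_vec n \<Longrightarrow> dual_vec x y \<in> carrier_vec n"
  by (simp add: dual_vec_def)

lemma map_part_dual_vec: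
  assumes "x \<in> carrier_vec n" "y \<in> carrier_vec n"
  shows "map_vec part0 (dual_vec x y) = x" "map_vec part1 (dual_vec x y) = y"
  by (rule eq_vecI; use assms in \<open>simp add: dual_vec_def\<close>)+

lemma dual_vec_eq_0_iff:
  fixes w :: "'a::field dual_number vec"
  assumes "w \<in> carrier_vec n"
  shows "w = 0\<^sub>v n \<longleftrightarrow> map_vec part0 w = 0\<^sub>v n \<and> map_vec part1 w = 0\<^sub>v n"
  using assms by (auto simp: vec_eq_iff dual_number_eq_iff)

section \<open>Row spans, their duals and the LCD property\<close>

lemma row_span_eq:
  fixes B :: "'a::field dual_number mat"
  shows "row_span B = (\<lambda>w. transpose_mat B *\<^sub>v w) ` carrier_vec (dim_row B)"
proof -
  interpret V: vec_module "TYPE('a dual_number)" "dim_col B" .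
  let ?T = "(\<lambda>w. transpose_mat B *\<^sub>v w) ` carrier_vec (dim_row B)"
  have tB: "transpose_mat B \<in> carrier_mat (dim_col B) (dim_row B)" by simp
  have "submodule class_ring ?T V.V"
  proof (rule submodule.intro)
    show "?T \<subseteq> carrier V.V" using mult_mat_vec_carrier[OF tB] by (auto simp: module_vec_simps)
    show "\<zero>\<^bsub>V.V\<^esub> \<in> ?T"
      by (rule image_eqI[of _ _ "0\<^sub>v (dim_row B)"]) (auto simp: module_vec_simps)
    show "v \<oplus>\<^bsub>V.V\<^esub> w \<in> ?T" if "v \<in> ?T" "w \<in> ?T" for v w
    proof -
      from that obtain a b where "a \<in> carrier_vec (dim_row B)" "b \<in> carrier_vec (dim_row B)"
        "v = transpose_mat B *\<^sub>v a" "w = transpose_mat B *\<^sub>v b" by auto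
      then show ?thesis
        by (intro image_eqI[of _ _ "a + b"])
          (auto simp: module_vec_simps mult_add_distrib_mat_vec[OF tB])
    qed
    show "c \<odot>\<^bsub>V.V\<^esub> v \<in> ?T" if "c \<in> carrier class_ring" "v \<in> ?T" for c v
    proof -
      from that obtain a where "a \<in> carrier_vec (dim_row B)" "v = transpose_mat B *\<^sub>v a" by auto
      then have "transpose_mat B *\<^sub>v (c \<cdot>\<^sub>v a) = c \<cdot>\<^sub>v v"
        by (intro eq_vecI) auto
      then show ?thesis
        using \<open>a \<in> carrier_vec (dim_row B)\<close>
        by (intro image_eqI[of _ _ "c \<cdot>\<^sub>v a"]) (auto simp: module_vec_simps)
    qed
  qed (rule V.module_axioms)
  moreover have "set (rows B) \<subseteq> ?T"
  proof
    fix r assume "r \<in> set (rows B)"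
    then obtain i where i: "i < dim_row B" "r = row B i" by (auto simp: rows_def)
    then have "r = transpose_mat B *\<^sub>v unit_vec (dim_row B) i" by (intro eq_vecI) auto
    then show "r \<in> ?T" by auto
  qed
  ultimately have "row_span B \<subseteq> ?T"
    unfolding row_span_def by (rule V.span_is_subset[rotated])
  moreover have "transpose_mat B *\<^sub>v w \<in> row_span B" if w: "w \<in> carrier_vec (dim_row B)" for w
  proof -
    \<comment> \<open>A single combination \<open>B^T w\<close> is the row of a one-row product, so
      \<open>row_span_mult_subset\<close> applies to it.\<close>
    define M where "M = mat_of_rows (dim_row B) [w]"
    have M: "M \<in> carrier_mat 1 (dim_row B)" using mat_of_rows_carrier(1)[of "dim_row B" "[w]"] by (simp add: M_def)
    have "transpose_mat B *\<^sub>v w = row (M * B) 0"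
      using w M by (intro eq_vecI) (auto simp: M_def intro: comm_scalar_prod[of _ "dim_row B"])
    moreover have "row (M * B) 0 \<in> set (rows (M * B))"
      using M by (auto simp: rows_def)
    moreover have "set (rows (M * B)) \<subseteq> row_span (M * B)"
    proof -
      interpret W: vec_module "TYPE('a dual_number)" "dim_col (M * B)" .
      show ?thesis unfolding row_span_def by (rule W.in_own_span[OF rows_carrier])
    qed
    ultimately show ?thesis using row_span_mult_subset[OF M] by auto
  qed
  ultimately show ?thesis by auto
qed

lemma linear_code_row_span:
  fixes B :: "'a::field dual_number mat"
  assumes "B \<in> carrier_mat k N"
  shows "linear_code N (row_span B)"
proof -
  interpret V: vec_module "TYPE('a dual_number)" N .
  have "set (rows B) \<subseteq> carrier V.V" using assms by (auto simp: rows_def module_vec_simps)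
  from V.span_is_submodule[OF this[unfolded module_vec_simps]] show ?thesis
    using assms by (simp add: linear_code_def row_span_def)
qed

lemma dual_code_row_span:
  fixes B :: "'a::field dual_number mat"
  assumes B: "B \<in> carrier_mat k N"
  shows "dual_code N (row_span B) = {x \<in> carrier_vec N. B *\<^sub>v x = 0\<^sub>v k}"
proof -
  have "(\<forall>c\<in>row_span B. x \<bullet> c = 0) \<longleftrightarrow> B *\<^sub>v x = 0\<^sub>v k" if x: "x \<in> carrier_vec N" for x
  proof -
    have sp: "x \<bullet> (transpose_mat B *\<^sub>v w) = (B *\<^sub>v x) \<bullet> w" if "w \<in> carrier_vec k" for w
      using transpose_vec_mult_scalar[OF B x that] x that B
      by (simp add: comm_scalar_prod[of x N] comm_scalar_prod[of "B *\<^sub>v x" k])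
    have "B *\<^sub>v x = 0\<^sub>v k" if "\<forall>w \<in> carrier_vec k. (B *\<^sub>v x) \<bullet> w = 0"
    proof (rule eq_vecI)
      fix i assume "i < dim_vec (0\<^sub>v k :: 'a dual_number vec)"
      then have i: "i < k" by simp
      have "B *\<^sub>v x \<in> carrier_vec k" using mult_mat_vec_carrier[OF B x] .
      then show "(B *\<^sub>v x) $ i = 0\<^sub>v k $ i"
        using bspec[OF that, of "unit_vec k i"] i by simp
    qed (use B in simp)
    then show ?thesis using sp B by (auto simp: row_span_eq)
  qed
  then show ?thesis by (auto simp: dual_code_def)
qed

text \<open>Codewords are the vectors \<open>B^T w\<close> and the dual code is the kernel of
  \<open>B\<close>, so triviality of their intersection becomes a statement about coefficient
  vectors.\<close>

lemma lcd_code_row_span_iff: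
  fixes B :: "'a::field dual_number mat"
  assumes B: "B \<in> carrier_mat k N"
  shows "lcd_code N (row_span B) \<longleftrightarrow>
    (\<forall>w \<in> carrier_vec k. B * transpose_mat B *\<^sub>v w = 0\<^sub>v k \<longrightarrow> transpose_mat B *\<^sub>v w = 0\<^sub>v N)"
proof -
  have assoc: "B * transpose_mat B *\<^sub>v w = B *\<^sub>v (transpose_mat B *\<^sub>v w)" if "w \<in> carrier_vec k" for w
    using that B by (intro assoc_mult_mat_vec) auto
  have "transpose_mat B *\<^sub>v 0\<^sub>v k = 0\<^sub>v N" "B *\<^sub>v 0\<^sub>v N = 0\<^sub>v k"
    by (rule eq_vecI; use B in simp)+
  moreover have rs: "row_span B = (\<lambda>w. transpose_mat B *\<^sub>v w) ` carrier_vec k"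
    using B by (simp add: row_span_eq)
  ultimately have "0\<^sub>v N \<in> row_span B" "0\<^sub>v N \<in> dual_code N (row_span B)"
    unfolding dual_code_row_span[OF B] by (metis imageI zero_carrier_vec, simp)
  moreover have "row_span B \<subseteq> carrier_vec N"
    unfolding rs using mult_mat_vec_carrier[of "transpose_mat B" N k] B by (simp add: image_subset_iff)
  ultimately have "lcd_code N (row_span B) \<longleftrightarrow> (\<forall>x \<in> row_span B. B *\<^sub>v x = 0\<^sub>v k \<longrightarrow> x = 0\<^sub>v N)"
    using linear_code_row_span[OF B]
    unfolding lcd_code_def dual_code_row_span[OF B] by blast
  then show ?thesis unfolding rs using assoc by simp
qed

text \<open>A nonsingular residue makes \<open>B B^T\<close> injective over R: the residue equation
  kills \<open>part0\<close> of \<open>w\<close>, and what then remains of the u-equation kills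
  \<open>part1\<close>.\<close>

lemma lcd_code_row_spanI:
  fixes B :: "'a::field dual_number mat"
  assumes B: "B \<in> carrier_mat k N" and det: "det (map_mat part0 (B * transpose_mat B)) \<noteq> 0"
  shows "lcd_code N (row_span B)"
  unfolding lcd_code_row_span_iff[OF B]
proof (intro ballI impI)
  define M where "M = B * transpose_mat B"
  fix w assume w: "w \<in> carrier_vec k" and "B * transpose_mat B *\<^sub>v w = 0\<^sub>v k"
  then have Mw: "M *\<^sub>v w = 0\<^sub>v k" by (simp only: M_def)
  have M: "M \<in> carrier_mat k k" using B by (simp add: M_def)
  have M0: "map_mat part0 M \<in> carrier_mat k k" and M1: "map_mat part1 M \<in> carrier_mat k k"
    using M by auto
  have inj: "v = 0\<^sub>v k" if "v \<in> carrier_vec k" "map_mat part0 M *\<^sub>v v = 0\<^sub>v k" for v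
    using that det unfolding M_def[symmetric] det_0_iff_vec_prod_zero_field[OF M0] by blast
  have carr: "map_vec part0 w \<in> carrier_vec k" "map_vec part1 w \<in> carrier_vec k"
    using w by simp_all
  have "map_mat part0 M *\<^sub>v map_vec part0 w = 0\<^sub>v k"
    unfolding part_mult_mat_vec(1)[OF M w, symmetric] Mw map_part_zero_vec ..
  from inj[OF carr(1) this] have w0: "map_vec part0 w = 0\<^sub>v k" .
  have "map_mat part1 M *\<^sub>v 0\<^sub>v k = 0\<^sub>v k"
    by (rule eq_vecI) (use M1 in auto)
  moreover have "map_mat part0 M *\<^sub>v map_vec part1 w \<in> carrier_vec k"
    using mult_mat_vec_carrier[OF M0 carr(2)] .
  ultimately have "map_mat part0 M *\<^sub>v map_vec part1 w = 0\<^sub>v k"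
    using part_mult_mat_vec(2)[OF M w] unfolding Mw w0 map_part_zero_vec by simp
  from inj[OF carr(2) this] have "map_vec part1 w = 0\<^sub>v k" .
  with w0 have w_eq: "w = 0\<^sub>v k" using dual_vec_eq_0_iff[OF w] by simp
  show "transpose_mat B *\<^sub>v w = 0\<^sub>v N"
    unfolding w_eq by (rule eq_vecI) (use B in auto)
qed

text \<open>The assumption \<open>unique\<close> says that relations among the rows have all
  coefficients in uR. This is the form in which uniqueness of representations survives for
  generators in (uR)^n, whose coefficients matter only modulo u.\<close>

lemma lcd_code_row_spanD:
  fixes B :: "'a::field dual_number mat"
  assumes B: "B \<in> carrier_mat k N" and lcd: "lcd_code N (row_span B)"
    and unique: "\<And>w. w \<in> carrier_vec k \<Longrightarrow> transpose_mat B *\<^sub>v w = 0\<^sub>v N \<Longrightarrow> map_vec part0 w = 0\<^sub>v k"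
  shows "det (map_mat part0 (B * transpose_mat B)) \<noteq> 0"
proof
  define M where "M = B * transpose_mat B"
  define M0 M1 where "M0 = map_mat part0 M" and "M1 = map_mat part1 M"
  assume "det (map_mat part0 (B * transpose_mat B)) = 0"
  then have det: "det M0 = 0" by (simp add: M0_def M_def)
  have tB: "transpose_mat B \<in> carrier_mat N k" using B by simp
  have M: "M \<in> carrier_mat k k" using B by (simp add: M_def)
  have M0: "M0 \<in> carrier_mat k k" and M1: "M1 \<in> carrier_mat k k"
    using M by (auto simp: M0_def M1_def)
  have "transpose_mat M = M" using B tB by (simp add: M_def transpose_mult)
  then have sym0: "transpose_mat M0 = M0"
    using M by (metis M0_def map_mat_transpose)
  \<comment> \<open>The last two conditions are the residue and the u-part of
    \<open>M (x + u y) = 0\<close>; the LCD property turns this into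
    \<open>B^T (x + u y) = 0\<close>.\<close>
  have kernel: "transpose_mat B *\<^sub>v dual_vec x y = 0\<^sub>v N"
    if x: "x \<in> carrier_vec k" and y: "y \<in> carrier_vec k" and "M0 *\<^sub>v x = 0\<^sub>v k" "M0 *\<^sub>v y + M1 *\<^sub>v x = 0\<^sub>v k" for x y
  proof -
    have "M *\<^sub>v dual_vec x y = 0\<^sub>v k"
      using that part_mult_mat_vec[OF M dual_vec_carrier[OF x]] M
      by (simp add: dual_vec_eq_0_iff[of _ k] map_part_dual_vec[OF x y] M0_def M1_def mult_mat_vec_carrier[OF M dual_vec_carrier[OF x]])
    then show ?thesis
      using lcd dual_vec_carrier[OF x] unfolding lcd_code_row_span_iff[OF B] M_def by blast
  qed
  \<comment> \<open>If \<open>M0\<close> kills \<open>x\<close>, then \<open>M (u x) = 0\<close>, so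
    \<open>kernel\<close> gives \<open>B^T (u x) = 0\<close>. The u-part of this equation is the
    residue of \<open>B^T x\<close>, hence \<open>B^T x\<close> is a multiple of u.\<close>
  have kernel0: "map_vec part0 (transpose_mat B *\<^sub>v dual_vec x (0\<^sub>v k)) = 0\<^sub>v N"
    if x: "x \<in> carrier_vec k" and "M0 *\<^sub>v x = 0\<^sub>v k" for x
  proof -
    have z: "0\<^sub>v k \<in> carrier_vec k" by simp
    have zero: "A *\<^sub>v 0\<^sub>v k = 0\<^sub>v n" if "A \<in> carrier_mat n k" for A :: "'a mat" and n
      using that by (intro eq_vecI) auto
    have tB0: "map_mat part0 (transpose_mat B) \<in> carrier_mat N k"
      and tB1: "map_mat part1 (transpose_mat B) \<in> carrier_mat N k" using tB by auto
    have "transpose_mat B *\<^sub>v dual_vec (0\<^sub>v k) x = 0\<^sub>v N"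
      using that M0 M1 by (intro kernel) (simp_all add: zero)
    then have "map_vec part1 (transpose_mat B *\<^sub>v dual_vec (0\<^sub>v k) x) = 0\<^sub>v N"
      by (simp add: map_part_zero_vec)
    then have "map_mat part0 (transpose_mat B) *\<^sub>v x = 0\<^sub>v N"
      using part_mult_mat_vec(2)[OF tB dual_vec_carrier[OF z]] map_part_dual_vec[OF z x] zero[OF tB1]
        mult_mat_vec_carrier[OF tB0 x] by simp
    then show ?thesis
      using part_mult_mat_vec(1)[OF tB dual_vec_carrier[OF x]] map_part_dual_vec[OF x z] by simp
  qed
  obtain v where v: "v \<in> carrier_vec k" "v \<noteq> 0\<^sub>v k" "M0 *\<^sub>v v = 0\<^sub>v k"
    using det det_0_iff_vec_prod_zero_field[OF M0] by blast
  \<comment> \<open>By \<open>kernel0\<close> both \<open>B^T x\<close> and \<open>B^T v\<close> are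
    multiples of u, so their dot product vanishes because u^2 = 0. That product equals
    \<open>x . M v\<close>, whose u-part is \<open>x . M1 v\<close>.\<close>
  have "x \<bullet> (M1 *\<^sub>v v) = 0" if x: "x \<in> carrier_vec k" "M0 *\<^sub>v x = 0\<^sub>v k" for x
  proof -
    let ?x = "dual_vec x (0\<^sub>v k)" and ?v = "dual_vec v (0\<^sub>v k)"
    have c: "?x \<in> carrier_vec k" "?v \<in> carrier_vec k" using x v by (simp_all add: dual_vec_carrier)
    have Mv: "M *\<^sub>v ?v \<in> carrier_vec k" using mult_mat_vec_carrier[OF M c(2)] .
    have "M0 *\<^sub>v 0\<^sub>v k = 0\<^sub>v k" using M0 by (intro eq_vecI) auto
    then have "map_vec part1 (M *\<^sub>v ?v) = M1 *\<^sub>v v"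
      using part_mult_mat_vec(2)[OF M c(2)] map_part_dual_vec[OF v(1), of "0\<^sub>v k"]
        mult_mat_vec_carrier[OF M1 v(1)]
      by (simp add: M0_def M1_def)
    moreover have "map_vec part0 (M *\<^sub>v ?v) = 0\<^sub>v k"
      using part_mult_mat_vec(1)[OF M c(2)] map_part_dual_vec[OF v(1), of "0\<^sub>v k"] v(3)
      by (simp add: M0_def)
    ultimately have "x \<bullet> (M1 *\<^sub>v v) = part1 (?x \<bullet> (M *\<^sub>v ?v))"
      using part_scalar_prod(2)[OF c(1) Mv] map_part_dual_vec[OF x(1), of "0\<^sub>v k"] by simp
    also have "?x \<bullet> (M *\<^sub>v ?v) = ?x \<bullet> (B *\<^sub>v (transpose_mat B *\<^sub>v ?v))"
      using assoc_mult_mat_vec[OF B tB c(2)] by (simp add: M_def)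
    also have "\<dots> = (transpose_mat B *\<^sub>v ?x) \<bullet> (transpose_mat B *\<^sub>v ?v)"
      using transpose_vec_mult_scalar[OF B mult_mat_vec_carrier[OF tB c(2)] c(1)] by simp
    also have "part1 \<dots> = 0"
      using part_scalar_prod(2)[OF mult_mat_vec_carrier[OF tB c(1)] mult_mat_vec_carrier[OF tB c(2)]]
        kernel0[OF x] kernel0[OF v(1,3)] mult_mat_vec_carrier[OF tB c(1)] mult_mat_vec_carrier[OF tB c(2)]
      by simp
    finally show ?thesis .
  qed
  then obtain z where z: "z \<in> carrier_vec k" "M0 *\<^sub>v z = M1 *\<^sub>v v"
    using symmetric_Fredholm[OF M0 sym0 mult_mat_vec_carrier[OF M1 v(1)]] by auto
  have "M0 *\<^sub>v (- z) + M1 *\<^sub>v v = 0\<^sub>v k"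
    using z v M0 M1 by (intro eq_vecI) (simp_all add: flip: z(2))
  then have "transpose_mat B *\<^sub>v dual_vec v (- z) = 0\<^sub>v N"
    using z v by (intro kernel) simp_all
  from unique[OF dual_vec_carrier[OF v(1)] this] show False
    using v z map_part_dual_vec(1)[OF v(1), of "- z"] by simp
qed

section \<open>The minimal length of an LCD embedding\<close>

theorem theorem6p1:
  fixes C :: "'a::{field,finite} dual_number vec set"
    and G :: "'a dual_number mat"
    and A0 A1 :: "'a mat"
    and n k r :: nat
  assumes "linear_code n C"
    and "generator_matrix n C G"
    and "k = dim_row G"
    and "A0 \<in> carrier_mat k k"
    and "A1 \<in> carrier_mat k k"
    and "G * transpose_mat G = map_mat base A0 + u \<cdot>\<^sub>m map_mat base A1"
    and "r = vec_space.rank k A0"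
  shows "min_lcd_embedding_length n C = n + k - r"
proof -
  interpret vec_space "TYPE('a)" k .
  note C = assms(1) and gen = assms(2) and A0 = assms(4)
  have G: "G \<in> carrier_mat k n"
    using gen assms(3) unfolding generator_matrix_def by (metis carrier_matI)
  have tG: "transpose_mat G \<in> carrier_mat n k" using G by simp
  have C0: "0\<^sub>v n \<in> C"
    using submodule.zero_closed[OF C[unfolded linear_code_def]] by (simp add: module_vec_simps)
  have GG: "map_mat part0 (G * transpose_mat G) = A0"
    unfolding assms(6) by (rule eq_matI) (use assms(4,5) in auto)
  have "transpose_mat (G * transpose_mat G) = G * transpose_mat G"
    using G tG by (simp add: transpose_mult)
  then have sym: "transpose_mat A0 = A0" using GG by (metis map_mat_transpose)
  have r: "r \<le> k" using rank_le_nc[OF A0] assms(7) by simp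
  have B: "append_cols G D \<in> carrier_mat k (n + m)" if "D \<in> carrier_mat k m" for D m
    using G that by (intro carrier_matI) (auto simp: append_cols_def)
  \<comment> \<open>The block form gives the Gram matrix \<open>G G^T + D D^T\<close>, and taking
    residues respects sums and products.\<close>
  have gram: "map_mat part0 (append_cols G D * transpose_mat (append_cols G D)) =
      A0 + map_mat part0 D * transpose_mat (map_mat part0 D)" if D: "D \<in> carrier_mat k m" for D m
  proof -
    have split: "(\<Sum>i = 0..<n + m. f i) = (\<Sum>i = 0..<n. f i) + (\<Sum>i = 0..<m. f (n + i))" for f :: "nat \<Rightarrow> 'a"
      by (induction m) (simp_all add: add.assoc)
    show ?thesis
      unfolding GG[symmetric]
      by (rule eq_matI)
        (use G D in \<open>auto simp: append_cols_def scalar_prod_def part_sum split\<close>)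
  qed
  have lcd_iff: "lcd_code (n + m) (row_span (append_cols G D)) \<longleftrightarrow>
      det (A0 + map_mat part0 D * transpose_mat (map_mat part0 D)) \<noteq> 0"
    if D: "D \<in> carrier_mat k m" for D m
    unfolding gram[OF D, symmetric]
  proof
    assume lcd: "lcd_code (n + m) (row_span (append_cols G D))"
    show "det (map_mat part0 (append_cols G D * transpose_mat (append_cols G D))) \<noteq> 0"
    proof (rule lcd_code_row_spanD[OF B[OF D] lcd])
      fix w assume w: "w \<in> carrier_vec k" and 0: "transpose_mat (append_cols G D) *\<^sub>v w = 0\<^sub>v (n + m)"
      \<comment> \<open>The first \<open>n\<close> columns of \<open>[G | D]\<close> are those of
        \<open>G\<close>, so a relation among its rows is also one among the rows of
        \<open>G\<close>, where uniqueness of representations applies.\<close>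
      have "transpose_mat G *\<^sub>v w = 0\<^sub>v n"
      proof (rule eq_vecI)
        fix i assume "i < dim_vec (0\<^sub>v n :: 'a dual_number vec)"
        then have i: "i < n" by simp
        have "col (append_cols G D) i = col G i"
          by (rule eq_vecI) (use i G D in \<open>auto simp: append_cols_def\<close>)
        then show "(transpose_mat G *\<^sub>v w) $ i = 0\<^sub>v n $ i"
          using arg_cong[OF 0, of "\<lambda>x. x $ i"] i G B[OF D] by simp
      qed (use G in simp)
      then have "part0 (w $ i) = 0" if "i < k" for i
        using generator_matrix_unique[OF gen C0, of w i] w that assms(3) by simp
      then show "map_vec part0 w = 0\<^sub>v k" using w by (intro eq_vecI) auto
    qed
  qed (rule lcd_code_row_spanI[OF B[OF D]])
  have ex: "\<exists>E. lcd_embedding n C (n + k - r) E"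
  proof -
    have "k \<le> rank A0 + (k - r)" using assms(7) by simp
    from exists_nonsingular_gram_update[OF A0 sym this]
    obtain D where D: "D \<in> carrier_mat k (k - r)" and det: "det (A0 + D * transpose_mat D) \<noteq> 0" ..
    \<comment> \<open>The criterion \<open>lcd_iff\<close> sees only the residue of the added block,
      so the matrix found over the field is lifted by \<open>base\<close>.\<close>
    have "map_mat part0 (map_mat base D) = D" by (rule eq_matI) auto
    then have "lcd_code (n + (k - r)) (row_span (append_cols G (map_mat base D)))"
      using lcd_iff[of "map_mat base D" "k - r"] D det by simp
    moreover have "n + (k - r) = n + k - r" using r by simp
    ultimately show ?thesis
      unfolding lcd_embedding_iff[OF C gen] using D assms(3) by (metis map_carrier_mat)
  qed
  have "n + k - r \<le> N" if "lcd_embedding n C N E" for N E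
  proof -
    \<comment> \<open>\<open>lcd_embedding_iff\<close> trades the generator matrix from which the
      embedding was built for the fixed \<open>G\<close>, so that \<open>lcd_iff\<close> applies
      with \<open>A0\<close>.\<close>
    from that obtain m D where D: "D \<in> carrier_mat k m" and N: "N = n + m"
      and "E = row_span (append_cols G D)" and "lcd_code N E"
      unfolding lcd_embedding_iff[OF C gen] assms(3)[symmetric] by (elim conjE exE)
    then have lcd: "lcd_code N (row_span (append_cols G D))" by simp
    define D0 where "D0 = map_mat part0 D"
    have D0: "D0 \<in> carrier_mat k m" "transpose_mat D0 \<in> carrier_mat m k"
      using D by (auto simp: D0_def)
    then have DD: "D0 * transpose_mat D0 \<in> carrier_mat k k" by simp
    \<comment> \<open>Nonsingularity means full rank \<open>k\<close>; the part not supplied by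
      \<open>A0\<close> must come from \<open>D0 D0^T\<close>, a product through dimension
      \<open>m\<close>.\<close>
    have "k = rank (A0 + D0 * transpose_mat D0)"
      using lcd_iff[OF D] lcd N det_rank_iff[of "A0 + D0 * transpose_mat D0"] A0 DD
      by (simp add: D0_def)
    also have "\<dots> \<le> r + rank (D0 * transpose_mat D0)"
      using rank_subadditive[OF A0 DD] assms(7) by simp
    also have "\<dots> \<le> r + m" using rank_mult_le_inner_dim[OF D0] by simp
    finally show ?thesis using N by simp
  qed
  with ex show ?thesis
    unfolding min_lcd_embedding_length_def by (intro Least_equality) auto
qed

end
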